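(* Let $\Omega$ be an open subset of $\mathbb{R}^d$, let $f\in\mathcal{G}(\Omega)$ be a Colombeau generalized function (in particular, a Schwartz distribution), and let $f:\mu_v(\Omega)\to\overline{\mathbb{C}}$ be its graph. Then there exist $f_n:\mu_v(\Omega)\to\overline{\mathbb{C}}$, $f_n\neq0$, and $r_n:\mu_v(\Omega)\to\mathbb{R}$, $n=0,1,2,\dots$, such that for every $\xi\in\mu_v(\Omega)$: (a) $\sum_{n=0}^\infty\frac{f_n(\xi)}{\lambda^{r_n(\xi)}}$ is a $v$-asymptotic series in $\overline{\mathbb{C}}$ (which, among other things, implies that $v(f_n(\xi))=0$); (b) $f(\xi)\leadsto\sum_{n=0}^\infty\frac{f_n(\xi)}{\lambda^{r_n(\xi)}}$ in $\overline{\mathbb{C}}$.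
   Context: $G_\infty(\mathbb{R},\mathbb{C})$ is the ring of germs at $+\infty$ of complex valued functions defined on a subset of $\mathbb{R}$ containing some $(n,\infty)$, $n\in\mathbb{N}$. $\mathcal{M}=\{f\in G_\infty(\mathbb{R},\mathbb{C}): f(x)=O(x^n)\text{ as }x\to\infty\text{ for some }n\in\mathbb{N}\}$, $\mathcal{N}=\{f\in G_\infty(\mathbb{R},\mathbb{C}): f(x)=O(1/x^n)\text{ as }x\to\infty\text{ for all }n\in\mathbb{N}\}$, and $v(f)=\sup\{r\in\mathbb{R}: f(x)=O(1/x^r)\text{ as }x\to\infty\}\in\mathbb{R}\cup\{\infty\}$ for $f\in\mathcal{M}$. Colombeau's ring of complex generalized numbers is $\overline{\mathbb{C}}=\mathcal{M}/\mathcal{N}$ with quotient map $q$, and $v(q(f))=v(f)$; $\overline{\mathbb{R}}=\{q(f): f\in\mathcal{M},\ f(x)\in\mathbb{R}\text{ for all sufficiently large }x\}$. The scale is $\lambda=q(\mathrm{id})$, where $\mathrm{id}(x)=x$, and $\lambda^r=q(x^r)$ for $r\in\mathbb{R}$. $\mu_v(\Omega)=\{\omega+d\omega : \omega\in\Omega,\ d\omega\in\overline{\mathbb{R}}^{\,d},\ v(\|d\omega\|)>0\}$. $\mathcal{G}(\Omega)$ is Colombeau's algebra of generalized functions on $\Omega$, which contains a canonical copy of the space of Schwartz distributions, $\mathcal{D}'(\Omega)\subset\mathcal{G}(\Omega)$. Written with the parameter $x=1/\varepsilon\to\infty$, it is the quotient of the algebra of families $(u_x)$ of functions in $C^\infty(\Omega)$,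 defined for all sufficiently large $x$, such that for every compact $K\subset\Omega$ and every multi-index $\alpha$ there is $N\in\mathbb{N}$ with $\sup_K|\partial^\alpha u_x|=O(x^N)$ as $x\to\infty$, modulo the ideal of families such that $\sup_K|\partial^\alpha u_x|=O(x^{-N})$ for all $K$, $\alpha$ and $N\in\mathbb{N}$. The graph of $f=[(u_x)]$ is its function of point values: $f(\xi)=q(x\mapsto u_x(\xi_x))$ for $\xi\in\mu_v(\Omega)$, where $(\xi_x)$ is a representative of $\xi$ lying, for large $x$, in a compact subset of $\Omega$. A set $\mathbb{F}\subset\overline{\mathbb{C}}$ is linearly $v$-independent over $\mathbb{C}$ if $v(a)=0$ for all $a\in\mathrm{Span}_{\mathbb{C}}(\mathbb{F})$, $a\neq0$. A series $\sum_{n=0}^\infty a_n/\lambda^{r_n}$ in $\overline{\mathbb{C}}$ is called $v$-asymptotic if (1) the set of coefficients $\{a_n: n\ge0\}$ is linearly $v$-independent over $\mathbb{C}$, and (2) the restriction of the sequence $(r_n)$ to $\{n: a_n\neq0\}$ is a strictly increasing (finite or infinite) sequence in $\mathbb{R}$. For $a\in\overline{\mathbb{C}}$ one writes $a\leadsto\sum_{n=0}^\infty a_n/\lambda^{r_n}$ (the series is a $v$-asymptotic expansion of $a$) if the series is $v$-asymptotic and for every $n\ge0$ with $a_n\ne0$ one has $v\big(a-\sum_{k=0}^n a_k/\lambda^{r_k}\big)>r_n$.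
   Formalization: f_n ≠ 0 is claimed only when the graph of f is not identically 0 on μ_v(Ω), and v(f_n(ξ)) = 0 only where f(ξ) ≠ 0, since the number 0 has only the expansion with all coefficients 0; (a) and (b) are proved for all f and ξ. *)

theory Defs
  imports "HOL-Analysis.Analysis" "HOL-Library.Landau_Symbols"
begin

section \<open>Generalized numbers\<close>

text \<open>
  A germ at \<open>+\<infinity>\<close> is represented by any total function that extends one of its members;
  all notions below depend only on the values at sufficiently large arguments.
\<close>

definition moderate :: "(real \<Rightarrow> complex) \<Rightarrow> bool" where
  "moderate f \<longleftrightarrow> (\<exists>n::nat. f \<in> O(\<lambda>x. of_real (x ^ n)))"

definition negligible_germ :: "(real \<Rightarrow> complex) \<Rightarrow> bool" where
  "negligible_germ f \<longleftrightarrow> (\<forall>n::nat. f \<in> O(\<lambda>x. of_real (1 / x ^ n)))"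

definition germ_val :: "(real \<Rightarrow> complex) \<Rightarrow> ereal" where
  "germ_val f = (SUP r\<in>{r::real. f \<in> O(\<lambda>x. of_real (1 / x powr r))}. ereal r)"

lemma bigo_powr_mono:
  assumes "f \<in> O(\<lambda>x. of_real (1 / x powr r) :: complex)" "s \<le> r"
  shows "f \<in> O(\<lambda>x. of_real (1 / x powr s) :: complex)"
proof -
  have "(\<lambda>x::real. of_real (1 / x powr r) :: complex) \<in> O(\<lambda>x. of_real (1 / x powr s))"
    by (rule landau_o.big_mono, rule eventually_mono[OF eventually_ge_at_top[of 1]])
       (use assms(2) in \<open>simp add: norm_divide frac_le powr_mono\<close>)
  then show ?thesis using assms(1) landau_o.big_trans by blast
qed

lemma bigo_pow_iff_powr:
  "f \<in> O(\<lambda>x. of_real (1 / x ^ n) :: complex) \<longleftrightarrow> f \<in> O(\<lambda>x. of_real (1 / x powr real n))"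
proof -
  have "eventually (\<lambda>x::real. of_real (1 / x ^ n) = (of_real (1 / x powr real n) :: complex)) at_top"
    using eventually_gt_at_top[of 0] by eventually_elim (simp add: powr_realpow)
  from landau_o.big.cong[OF this] show ?thesis by simp
qed

lemma bigo_pow_iff_powr':
  "f \<in> O(\<lambda>x. of_real (x ^ n) :: complex) \<longleftrightarrow> f \<in> O(\<lambda>x. of_real (1 / x powr (- real n)))"
proof -
  have "eventually (\<lambda>x::real. of_real (x ^ n) = (of_real (1 / x powr - real n) :: complex)) at_top"
    using eventually_gt_at_top[of 0] by eventually_elim (simp add: powr_realpow powr_minus divide_inverse)
  from landau_o.big.cong[OF this] show ?thesis by simp
qed

lemma moderate_iff_powr:
  "moderate f \<longleftrightarrow> (\<exists>r. f \<in> O(\<lambda>x. of_real (1 / x powr r)))"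
proof
  assume "moderate f"
  then show "\<exists>r. f \<in> O(\<lambda>x. of_real (1 / x powr r))"
    unfolding moderate_def bigo_pow_iff_powr' by blast
next
  assume "\<exists>r. f \<in> O(\<lambda>x. of_real (1 / x powr r))"
  then obtain r where r: "f \<in> O(\<lambda>x. of_real (1 / x powr r))" by blast
  have "- real (nat \<lceil>\<bar>r\<bar>\<rceil>) \<le> r" by linarith
  from bigo_powr_mono[OF r this] show "moderate f"
    unfolding moderate_def bigo_pow_iff_powr' by blast
qed

lemma negligible_iff_powr:
  "negligible_germ f \<longleftrightarrow> (\<forall>r. f \<in> O(\<lambda>x. of_real (1 / x powr r)))"
proof
  assume f: "negligible_germ f"
  show "\<forall>r. f \<in> O(\<lambda>x. of_real (1 / x powr r))"
  proof
    fix r :: real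
    have "r \<le> real (nat \<lceil>\<bar>r\<bar>\<rceil>)" by linarith
    with f show "f \<in> O(\<lambda>x. of_real (1 / x powr r))"
      unfolding negligible_germ_def bigo_pow_iff_powr using bigo_powr_mono by blast
  qed
qed (unfold negligible_germ_def bigo_pow_iff_powr, blast)

lemma moderate_bound:
  assumes "moderate g" "eventually (\<lambda>x. norm (f x) \<le> norm (g x)) at_top"
  shows "moderate f"
  using assms landau_o.big_mono landau_o.big_trans unfolding moderate_def by blast

lemma negligible_bound:
  assumes "negligible_germ g" "eventually (\<lambda>x. norm (f x) \<le> norm (g x)) at_top"
  shows "negligible_germ f"
  using assms landau_o.big_mono landau_o.big_trans unfolding negligible_germ_def by blast

lemma moderate_const [simp]: "moderate (\<lambda>x. c)"
  unfolding moderate_def by (rule exI[of _ 0]) simp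

lemma moderate_add:
  assumes "moderate f" "moderate g" shows "moderate (\<lambda>x. f x + g x)"
proof -
  from assms obtain r s where
    "f \<in> O(\<lambda>x. of_real (1 / x powr r))" "g \<in> O(\<lambda>x. of_real (1 / x powr s))"
    unfolding moderate_iff_powr by blast
  then have "f \<in> O(\<lambda>x. of_real (1 / x powr min r s))" "g \<in> O(\<lambda>x. of_real (1 / x powr min r s))"
    using bigo_powr_mono by (meson min.cobounded1 min.cobounded2)+
  then show ?thesis unfolding moderate_iff_powr using sum_in_bigo(1) by blast
qed

lemma moderate_mult:
  assumes "moderate f" "moderate g" shows "moderate (\<lambda>x. f x * g x)"
proof -
  from assms obtain n m where
    "f \<in> O(\<lambda>x. of_real (x ^ n))" "g \<in> O(\<lambda>x. of_real (x ^ m))"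
    unfolding moderate_def by blast
  from landau_o.big.mult[OF this] show ?thesis
    unfolding moderate_def by (intro exI[of _ "n + m"]) (simp add: power_add)
qed

lemma moderate_uminus: "moderate f \<Longrightarrow> moderate (\<lambda>x. - f x)"
  by (simp add: moderate_def)

lemma moderate_diff: "moderate f \<Longrightarrow> moderate g \<Longrightarrow> moderate (\<lambda>x. f x - g x)"
  using moderate_add[of f "\<lambda>x. - g x"] moderate_uminus by simp

lemma negligible_zero [simp]: "negligible_germ (\<lambda>x. 0)"
  by (simp add: negligible_germ_def)

lemma negligible_add:
  "negligible_germ f \<Longrightarrow> negligible_germ g \<Longrightarrow> negligible_germ (\<lambda>x. f x + g x)"
  by (simp add: negligible_germ_def sum_in_bigo)

lemma negligible_uminus: "negligible_germ f \<Longrightarrow> negligible_germ (\<lambda>x. - f x)"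
  by (simp add: negligible_germ_def)

lemma negligible_mult:
  assumes "negligible_germ f" "moderate g" shows "negligible_germ (\<lambda>x. f x * g x)"
proof -
  from assms(2) obtain s where s: "g \<in> O(\<lambda>x. of_real (1 / x powr s))"
    unfolding moderate_iff_powr by blast
  show ?thesis
    unfolding negligible_iff_powr
  proof
    fix r :: real
    have "f \<in> O(\<lambda>x. of_real (1 / x powr (r - s)))"
      using assms(1) by (simp add: negligible_iff_powr)
    from landau_o.big.mult[OF this s]
    have "(\<lambda>x. f x * g x) \<in> O(\<lambda>x. of_real (1 / x powr (r - s)) * of_real (1 / x powr s))" .
    also have "(\<lambda>x. of_real (1 / x powr (r - s)) * of_real (1 / x powr s) :: complex)
                 = (\<lambda>x. of_real (1 / x powr r))"
      by (auto simp flip: of_real_mult powr_add)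
    finally show "(\<lambda>x. f x * g x) \<in> O(\<lambda>x. of_real (1 / x powr r))" .
  qed
qed

lemma negligible_sum:
  "(\<And>i. i \<in> A \<Longrightarrow> negligible_germ (f i)) \<Longrightarrow> negligible_germ (\<lambda>x. \<Sum>i\<in>A. f i x)"
  by (induction A rule: infinite_finite_induct) (auto intro: negligible_add)

lemma moderate_sum:
  "(\<And>i. i \<in> A \<Longrightarrow> moderate (f i)) \<Longrightarrow> moderate (\<lambda>x. \<Sum>i\<in>A. f i x)"
  by (induction A rule: infinite_finite_induct) (auto intro: moderate_add)

definition germ_rel :: "(real \<Rightarrow> complex) \<Rightarrow> (real \<Rightarrow> complex) \<Rightarrow> bool" where
  "germ_rel f g \<longleftrightarrow> moderate f \<and> moderate g \<and> negligible_germ (\<lambda>x. f x - g x)"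

quotient_type gen_complex = "real \<Rightarrow> complex" / partial: germ_rel
proof (rule part_equivpI)
  show "\<exists>f. germ_rel f f"
    by (rule exI[of _ "\<lambda>x. 0"]) (simp add: germ_rel_def)
  show "symp germ_rel"
  proof (rule sympI)
    fix f g assume "germ_rel f g"
    then show "germ_rel g f"
      unfolding germ_rel_def using negligible_uminus[of "\<lambda>x. f x - g x"] by simp
  qed
  show "transp germ_rel"
  proof (rule transpI)
    fix f g h assume "germ_rel f g" "germ_rel g h"
    then show "germ_rel f h"
      unfolding germ_rel_def using negligible_add[of "\<lambda>x. f x - g x" "\<lambda>x. g x - h x"] by simp
  qed
qed

abbreviation gclass :: "(real \<Rightarrow> complex) \<Rightarrow> gen_complex" where
  "gclass \<equiv> abs_gen_complex"

instantiation gen_complex :: comm_ring_1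
begin

lift_definition zero_gen_complex :: gen_complex is "\<lambda>x. 0"
  by (simp add: germ_rel_def)

lift_definition one_gen_complex :: gen_complex is "\<lambda>x. 1"
  by (simp add: germ_rel_def)

lift_definition plus_gen_complex :: "gen_complex \<Rightarrow> gen_complex \<Rightarrow> gen_complex"
  is "\<lambda>f g x. f x + g x"
  unfolding germ_rel_def
  by (auto intro: moderate_add dest: negligible_add simp: algebra_simps)

lift_definition uminus_gen_complex :: "gen_complex \<Rightarrow> gen_complex" is "\<lambda>f x. - f x"
  unfolding germ_rel_def
  by (auto intro: moderate_uminus dest: negligible_uminus simp: algebra_simps)

lift_definition minus_gen_complex :: "gen_complex \<Rightarrow> gen_complex \<Rightarrow> gen_complex"
  is "\<lambda>f g x. f x - g x"
proof -
  fix f f' g g' assume *: "germ_rel f f'" "germ_rel g g'"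
  then have "negligible_germ (\<lambda>x. (f x - f' x) + - (g x - g' x))"
    unfolding germ_rel_def by (intro negligible_add negligible_uminus) auto
  then show "germ_rel (\<lambda>x. f x - g x) (\<lambda>x. f' x - g' x)"
    using * unfolding germ_rel_def by (auto intro: moderate_diff simp: algebra_simps)
qed

lift_definition times_gen_complex :: "gen_complex \<Rightarrow> gen_complex \<Rightarrow> gen_complex"
  is "\<lambda>f g x. f x * g x"
proof -
  fix f f' g g' assume *: "germ_rel f f'" "germ_rel g g'"
  then have "negligible_germ (\<lambda>x. (f x - f' x) * g x + (g x - g' x) * f' x)"
    unfolding germ_rel_def by (intro negligible_add negligible_mult) auto
  then show "germ_rel (\<lambda>x. f x * g x) (\<lambda>x. f' x * g' x)"
    using * unfolding germ_rel_def by (auto intro: moderate_mult simp: algebra_simps)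
qed

instance
proof
  show "(0::gen_complex) \<noteq> 1"
  proof
    assume "(0::gen_complex) = 1"
    then have "negligible_germ (\<lambda>x. 1)"
      by transfer (use negligible_uminus[of "\<lambda>x. -1"] in \<open>auto simp: germ_rel_def\<close>)
    then have "(\<lambda>x::real. 1 :: complex) \<in> O(\<lambda>x. of_real (1 / x ^ 1))"
      unfolding negligible_germ_def by blast
    then obtain c where c: "eventually (\<lambda>x::real. norm (1::complex) \<le> c * norm (of_real (1 / x ^ 1) :: complex)) at_top"
      by (rule landau_o.bigE)
    have "eventually (\<lambda>x::real. False) at_top"
      using c eventually_gt_at_top[of "max 0 c"]
      by eventually_elim (auto simp: norm_divide field_simps)
    then show False by simp
  qed
qed (transfer; auto simp: germ_rel_def algebra_simps intro: moderate_add moderate_mult moderate_uminus moderate_diff)+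

end

lemma germ_rel_refl: "germ_rel f f \<longleftrightarrow> moderate f"
  by (simp add: germ_rel_def)

lemma gclass_eq_iff:
  assumes "moderate f" "moderate g"
  shows "gclass f = gclass g \<longleftrightarrow> negligible_germ (\<lambda>x. f x - g x)"
  using Quotient3_rel[OF Quotient3_gen_complex, of f g] assms by (auto simp: germ_rel_def)

lemma moderate_rep [simp]: "moderate (rep_gen_complex a)"
  using Quotient3_rep_reflp[OF Quotient3_gen_complex, of a] by (simp add: germ_rel_def)

lemma gclass_rep [simp]: "gclass (rep_gen_complex a) = a"
  by (rule Quotient3_abs_rep[OF Quotient3_gen_complex])

lemma gen_complex_cases: obtains f where "moderate f" "a = gclass f"
  using moderate_rep[of a] gclass_rep[of a] by metis

lemma gclass_add: "moderate f \<Longrightarrow> moderate g \<Longrightarrow> gclass f + gclass g = gclass (\<lambda>x. f x + g x)"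
  by (simp add: plus_gen_complex.abs_eq germ_rel_refl)

lemma gclass_diff: "moderate f \<Longrightarrow> moderate g \<Longrightarrow> gclass f - gclass g = gclass (\<lambda>x. f x - g x)"
  by (simp add: minus_gen_complex.abs_eq germ_rel_refl)

lemma gclass_mult: "moderate f \<Longrightarrow> moderate g \<Longrightarrow> gclass f * gclass g = gclass (\<lambda>x. f x * g x)"
  by (simp add: times_gen_complex.abs_eq germ_rel_refl)

lift_definition val :: "gen_complex \<Rightarrow> ereal" is germ_val
proof -
  have sub: "g \<in> O(\<lambda>x. of_real (1 / x powr r))"
    if "germ_rel f g" "f \<in> O(\<lambda>x. of_real (1 / x powr r))" for f g r
  proof -
    have "(\<lambda>x. f x - g x) \<in> O(\<lambda>x. of_real (1 / x powr r))"
      using that(1) by (auto simp: germ_rel_def negligible_iff_powr)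
    from sum_in_bigo(2)[OF that(2) this] show ?thesis by simp
  qed
  fix f g assume fg: "germ_rel f g"
  then have "germ_rel g f"
    unfolding germ_rel_def using negligible_uminus[of "\<lambda>x. f x - g x"] by simp
  with fg have "{r. f \<in> O(\<lambda>x. of_real (1 / x powr r))} = {r. g \<in> O(\<lambda>x. of_real (1 / x powr r))}"
    using sub by blast
  then show "germ_val f = germ_val g" unfolding germ_val_def by simp
qed

lemma val_gclass: "moderate f \<Longrightarrow> val (gclass f) = germ_val f"
  by (simp add: val.abs_eq germ_rel_refl)

definition gen_real :: "gen_complex set" where
  "gen_real = {gclass f | f. moderate f \<and> (\<forall>\<^sub>F x in at_top. f x \<in> \<real>)}"

definition gconst :: "complex \<Rightarrow> gen_complex" where
  "gconst c = gclass (\<lambda>x. c)"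

definition gscale :: "complex \<Rightarrow> gen_complex \<Rightarrow> gen_complex" where
  "gscale c a = gconst c * a"

global_interpretation gen_complex: vector_space gscale
proof
  have "gconst (c + d) = gconst c + gconst d" "gconst (c * d) = gconst c * gconst d" for c d
    by (simp_all add: gconst_def gclass_add gclass_mult)
  moreover have "gconst 1 = 1" by (simp add: gconst_def one_gen_complex_def)
  ultimately show "gscale c (a + b) = gscale c a + gscale c b"
      "gscale (c + d) a = gscale c a + gscale d a"
      "gscale c (gscale d a) = gscale (c * d) a" "gscale 1 a = a" for c d a b
    by (simp_all add: gscale_def algebra_simps)
qed

definition lambda_powr :: "real \<Rightarrow> gen_complex" where
  "lambda_powr r = gclass (\<lambda>x. of_real (x powr r))"

lemma moderate_powr: "moderate (\<lambda>x. of_real (x powr r))"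
  unfolding moderate_iff_powr by (rule exI[of _ "- r"]) (simp add: powr_minus divide_inverse)

lemma lambda_powr_add: "lambda_powr (r + s) = lambda_powr r * lambda_powr s"
  by (simp add: lambda_powr_def gclass_mult moderate_powr powr_add)

lemma lambda_powr_0: "lambda_powr 0 = 1"
proof -
  have "negligible_germ (\<lambda>x. of_real (x powr 0) - 1)"
    by (rule negligible_bound[OF negligible_zero], rule eventually_mono[OF eventually_gt_at_top[of 0]]) simp
  then show ?thesis
    unfolding lambda_powr_def one_gen_complex_def
    by (subst gclass_eq_iff) (use moderate_powr[of 0] in auto)
qed

lemma lambda_powr_minus: "lambda_powr r * lambda_powr (- r) = 1"
  using lambda_powr_add[of r "- r"] by (simp add: lambda_powr_0)


section \<open>Asymptotic series\<close>

definition lin_v_independent :: "gen_complex set \<Rightarrow> bool" where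
  "lin_v_independent F \<longleftrightarrow> (\<forall>a\<in>gen_complex.span F. a \<noteq> 0 \<longrightarrow> val a = 0)"

text \<open>
  The pair \<open>(a, r)\<close> stands for the formal series with terms \<open>a n / lambda_powr (r n)\<close>.
  Zero coefficients are allowed, so finite series are included.
\<close>

definition v_asymptotic :: "(nat \<Rightarrow> gen_complex) \<Rightarrow> (nat \<Rightarrow> real) \<Rightarrow> bool" where
  "v_asymptotic a r \<longleftrightarrow> lin_v_independent (range a) \<and> strict_mono_on {n. a n \<noteq> 0} r"

text \<open>Division by \<open>lambda_powr r\<close> is multiplication by its inverse \<open>lambda_powr (- r)\<close>.\<close>

definition v_expansion :: "gen_complex \<Rightarrow> (nat \<Rightarrow> gen_complex) \<Rightarrow> (nat \<Rightarrow> real) \<Rightarrow> bool" where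
  "v_expansion c a r \<longleftrightarrow> v_asymptotic a r \<and>
     (\<forall>n. a n \<noteq> 0 \<longrightarrow> val (c - (\<Sum>k\<le>n. a k * lambda_powr (- r k))) > ereal (r n))"


section \<open>The monad\<close>

text \<open>
  The norm is taken on arbitrary representatives; \<open>gnorm_eq\<close> below shows that their
  choice does not matter.
\<close>

definition gnorm :: "gen_complex ^ 'd \<Rightarrow> gen_complex" where
  "gnorm a = gclass (\<lambda>x. of_real (norm (\<chi> i. rep_gen_complex (a $ i) x)))"

lemma norm_le_sum_norm: "norm (v :: 'a::real_normed_vector ^ 'd) \<le> (\<Sum>i\<in>UNIV. norm (v $ i))"
  unfolding norm_vec_def by (rule L2_set_le_sum) simp

lemma moderate_norm:
  assumes "\<And>i. moderate (p i)"
  shows "moderate (\<lambda>x. of_real (norm (\<chi> i::'d::finite. p i x)))"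
proof (rule moderate_bound)
  have "moderate (\<lambda>x. of_real (norm (p i x)))" for i
    by (rule moderate_bound[OF assms[of i]]) simp
  then show "moderate (\<lambda>x. \<Sum>i\<in>UNIV. of_real (norm (p i x)))"
    by (rule moderate_sum)
  show "\<forall>\<^sub>F x in at_top. norm (complex_of_real (norm (\<chi> i::'d. p i x)))
          \<le> norm (\<Sum>i\<in>UNIV. complex_of_real (norm (p i x)))"
    using norm_le_sum_norm[of "\<chi> i. p i _"]
    by (simp flip: of_real_sum add: sum_nonneg)
qed

lemma negligible_norm:
  assumes "\<And>i. negligible_germ (p i)"
  shows "negligible_germ (\<lambda>x. of_real (norm (\<chi> i::'d::finite. p i x)))"
proof (rule negligible_bound)
  have "negligible_germ (\<lambda>x. of_real (norm (p i x)))" for i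
    by (rule negligible_bound[OF assms[of i]]) simp
  then show "negligible_germ (\<lambda>x. \<Sum>i\<in>UNIV. of_real (norm (p i x)))"
    by (rule negligible_sum)
  show "\<forall>\<^sub>F x in at_top. norm (complex_of_real (norm (\<chi> i::'d. p i x)))
          \<le> norm (\<Sum>i\<in>UNIV. complex_of_real (norm (p i x)))"
    using norm_le_sum_norm[of "\<chi> i. p i _"]
    by (simp flip: of_real_sum add: sum_nonneg)
qed

lemma gnorm_eq:
  fixes a :: "gen_complex ^ 'd"
  assumes p: "\<And>i. moderate (p i)" and a: "\<And>i. a $ i = gclass (p i)"
  shows "gnorm a = gclass (\<lambda>x. of_real (norm (\<chi> i. p i x)))"
proof -
  let ?d = "\<lambda>i x. rep_gen_complex (a $ i) x - p i x"
  have "negligible_germ (?d i)" for i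
    using gclass_eq_iff[OF moderate_rep p, of "a $ i" i] a by simp
  then have "negligible_germ (\<lambda>x. of_real (norm (\<chi> i. ?d i x)))"
    by (rule negligible_norm)
  then have "negligible_germ (\<lambda>x. of_real (norm (\<chi> i. rep_gen_complex (a $ i) x))
                                  - of_real (norm (\<chi> i. p i x)))"
  proof (rule negligible_bound, intro always_eventually allI)
    fix x
    have "(\<chi> i. ?d i x) = (\<chi> i. rep_gen_complex (a $ i) x) - (\<chi> i. p i x)"
      by (simp add: vec_eq_iff)
    then show "norm (of_real (norm (\<chi> i. rep_gen_complex (a $ i) x)) - of_real (norm (\<chi> i. p i x)) :: complex)
        \<le> norm (of_real (norm (\<chi> i. ?d i x)) :: complex)"
      by (simp flip: of_real_diff add: norm_triangle_ineq3)
  qed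
  then show ?thesis
    unfolding gnorm_def by (subst gclass_eq_iff) (auto intro!: moderate_norm p)
qed

definition gvec :: "real ^ 'd \<Rightarrow> gen_complex ^ 'd" where
  "gvec w = (\<chi> i. gconst (of_real (w $ i)))"

definition mu_v :: "(real ^ 'd) set \<Rightarrow> (gen_complex ^ 'd) set" where
  "mu_v \<Omega> = {gvec w + dw | w dw. w \<in> \<Omega> \<and> (\<forall>i. dw $ i \<in> gen_real) \<and> val (gnorm dw) > 0}"


section \<open>Generalized functions\<close>

definition partial_deriv :: "'d \<Rightarrow> (real ^ 'd \<Rightarrow> complex) \<Rightarrow> real ^ 'd \<Rightarrow> complex" where
  "partial_deriv i g y = vector_derivative (\<lambda>t. g (y + t *\<^sub>R axis i 1)) (at 0)"

text \<open>
  A list of directions stands for the multi-index that counts the occurrences of each direction.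
  On smooth functions the order of the list is immaterial.
\<close>

primrec iter_partial :: "'d list \<Rightarrow> (real ^ 'd \<Rightarrow> complex) \<Rightarrow> real ^ 'd \<Rightarrow> complex" where
  "iter_partial [] g = g"
| "iter_partial (i # \<alpha>) g = partial_deriv i (iter_partial \<alpha> g)"

definition smooth_on :: "(real ^ 'd) set \<Rightarrow> (real ^ 'd \<Rightarrow> complex) \<Rightarrow> bool" where
  "smooth_on \<Omega> g \<longleftrightarrow> (\<forall>\<alpha>. continuous_on \<Omega> (iter_partial \<alpha> g) \<and>
     (\<forall>y\<in>\<Omega>. \<forall>i. (\<lambda>t. iter_partial \<alpha> g (y + t *\<^sub>R axis i 1)) differentiable at 0))"

text \<open>
  Families are total functions of the parameter and of the point; their values outside \<open>\<Omega>\<close>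
  or for small parameters play no role.  The empty compact set is left out because the supremum of
  the empty set of reals is unspecified.
\<close>

definition moderate_families :: "(real ^ 'd) set \<Rightarrow> (real \<Rightarrow> real ^ 'd \<Rightarrow> complex) set" where
  "moderate_families \<Omega> = {u. (\<forall>\<^sub>F x in at_top. smooth_on \<Omega> (u x)) \<and>
     (\<forall>K \<alpha>. compact K \<and> K \<noteq> {} \<and> K \<subseteq> \<Omega> \<longrightarrow>
       (\<exists>N::nat. (\<lambda>x. SUP y\<in>K. cmod (iter_partial \<alpha> (u x) y)) \<in> O(\<lambda>x. x ^ N)))}"

definition negligible_families :: "(real ^ 'd) set \<Rightarrow> (real \<Rightarrow> real ^ 'd \<Rightarrow> complex) set" where
  "negligible_families \<Omega> = {u. (\<forall>\<^sub>F x in at_top. smooth_on \<Omega> (u x)) \<and>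
     (\<forall>K \<alpha>. compact K \<and> K \<noteq> {} \<and> K \<subseteq> \<Omega> \<longrightarrow>
       (\<forall>N::nat. (\<lambda>x. SUP y\<in>K. cmod (iter_partial \<alpha> (u x) y)) \<in> O(\<lambda>x. 1 / x ^ N)))}"

definition colombeau_rel ::
  "(real ^ 'd) set \<Rightarrow> ((real \<Rightarrow> real ^ 'd \<Rightarrow> complex) \<times> (real \<Rightarrow> real ^ 'd \<Rightarrow> complex)) set" where
  "colombeau_rel \<Omega> = {(u, w). u \<in> moderate_families \<Omega> \<and> w \<in> moderate_families \<Omega> \<and>
     (\<lambda>x y. u x y - w x y) \<in> negligible_families \<Omega>}"

definition colombeau :: "(real ^ 'd) set \<Rightarrow> (real \<Rightarrow> real ^ 'd \<Rightarrow> complex) set set" where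
  "colombeau \<Omega> = moderate_families \<Omega> // colombeau_rel \<Omega>"

definition point_rep :: "(real ^ 'd) set \<Rightarrow> gen_complex ^ 'd \<Rightarrow> (real \<Rightarrow> real ^ 'd) \<Rightarrow> bool" where
  "point_rep \<Omega> \<xi> p \<longleftrightarrow>
     (\<forall>i. moderate (\<lambda>x. of_real (p x $ i)) \<and> \<xi> $ i = gclass (\<lambda>x. of_real (p x $ i))) \<and>
     (\<exists>K. compact K \<and> K \<subseteq> \<Omega> \<and> (\<forall>\<^sub>F x in at_top. p x \<in> K))"

text \<open>
  By \<open>mu_v_point_rep\<close> and \<open>colombeau_graph_eq\<close> below, on \<open>mu_v \<Omega>\<close> the description is
  satisfied by exactly one value.
\<close>

definition colombeau_graph :: "(real ^ 'd) set \<Rightarrow> (real \<Rightarrow> real ^ 'd \<Rightarrow> complex) set \<Rightarrow>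
    gen_complex ^ 'd \<Rightarrow> gen_complex" where
  "colombeau_graph \<Omega> f \<xi> = (THE c. \<exists>u\<in>f. \<exists>p. point_rep \<Omega> \<xi> p \<and> c = gclass (\<lambda>x. u x (p x)))"


subsection \<open>Independence of representatives\<close>

lemma vector_derivative_cong_line:
  fixes y :: "real ^ 'd"
  assumes "open \<Omega>" "y \<in> \<Omega>" "\<And>z. z \<in> \<Omega> \<Longrightarrow> f z = g z"
    and "((\<lambda>t. g (y + t *\<^sub>R axis i 1)) has_vector_derivative D) (at 0)"
  shows "((\<lambda>t. f (y + t *\<^sub>R axis i 1)) has_vector_derivative D) (at 0)"
proof (rule has_vector_derivative_transform_within_open[OF assms(4)])
  show "open ((\<lambda>t. y + t *\<^sub>R axis i 1) -` \<Omega>)"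
    by (intro open_vimage assms(1) continuous_intros)
qed (use assms in auto)

lemma smooth_on_has_vector_derivative:
  assumes "smooth_on \<Omega> g" "y \<in> \<Omega>"
  shows "((\<lambda>t. iter_partial \<alpha> g (y + t *\<^sub>R axis i 1))
           has_vector_derivative iter_partial (i # \<alpha>) g y) (at 0)"
  using assms unfolding smooth_on_def
  by (auto simp: partial_deriv_def vector_derivative_works)

lemma iter_partial_diff:
  assumes "open \<Omega>" "smooth_on \<Omega> g" "smooth_on \<Omega> h" "y \<in> \<Omega>"
  shows "iter_partial \<alpha> (\<lambda>y. g y - h y) y = iter_partial \<alpha> g y - iter_partial \<alpha> h y"
  using assms(4)
proof (induction \<alpha> arbitrary: y)
  case (Cons i \<alpha>)
  have "((\<lambda>t. iter_partial \<alpha> (\<lambda>y. g y - h y) (y + t *\<^sub>R axis i 1)) has_vector_derivative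
      (iter_partial (i # \<alpha>) g y - iter_partial (i # \<alpha>) h y)) (at 0)"
    by (rule vector_derivative_cong_line[OF assms(1) Cons.prems Cons.IH])
       (auto intro!: has_vector_derivative_diff
          smooth_on_has_vector_derivative[OF assms(2) Cons.prems, simplified]
          smooth_on_has_vector_derivative[OF assms(3) Cons.prems, simplified])
  then show ?case by (simp add: partial_deriv_def vector_derivative_at)
qed simp

lemma smooth_on_diff:
  assumes "open \<Omega>" "smooth_on \<Omega> g" "smooth_on \<Omega> h"
  shows "smooth_on \<Omega> (\<lambda>y. g y - h y)"
  unfolding smooth_on_def
proof (intro allI conjI ballI)
  fix \<alpha>
  have "continuous_on \<Omega> (\<lambda>y. iter_partial \<alpha> g y - iter_partial \<alpha> h y)"
    using assms by (intro continuous_intros) (auto simp: smooth_on_def)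
  then show "continuous_on \<Omega> (iter_partial \<alpha> (\<lambda>y. g y - h y))"
    by (subst continuous_on_cong[OF refl iter_partial_diff[OF assms]])
  fix y i assume y: "y \<in> \<Omega>"
  have "((\<lambda>t. iter_partial \<alpha> (\<lambda>y. g y - h y) (y + t *\<^sub>R axis i 1)) has_vector_derivative
      (iter_partial (i # \<alpha>) g y - iter_partial (i # \<alpha>) h y)) (at 0)"
    by (rule vector_derivative_cong_line[OF assms(1) y iter_partial_diff[OF assms]])
       (auto intro!: has_vector_derivative_diff
          smooth_on_has_vector_derivative[OF assms(2) y, simplified]
          smooth_on_has_vector_derivative[OF assms(3) y, simplified])
  then show "(\<lambda>t. iter_partial \<alpha> (\<lambda>y. g y - h y) (y + t *\<^sub>R axis i 1)) differentiable at 0"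
    by (rule differentiableI_vector)
qed

lemma iter_partial_zero: "iter_partial \<alpha> (\<lambda>y. 0) = (\<lambda>y. 0)"
  by (induction \<alpha>) (auto simp: partial_deriv_def)

lemma sup_upper:
  assumes "smooth_on \<Omega> g" "compact K" "K \<subseteq> \<Omega>" "y \<in> K"
  shows "cmod (iter_partial \<alpha> g y) \<le> (SUP y\<in>K. cmod (iter_partial \<alpha> g y))"
proof (rule cSUP_upper[OF assms(4)])
  have "continuous_on K (\<lambda>y. cmod (iter_partial \<alpha> g y))"
    using assms by (intro continuous_intros) (auto simp: smooth_on_def intro: continuous_on_subset)
  then show "bdd_above ((\<lambda>y. cmod (iter_partial \<alpha> g y)) ` K)"
    by (intro bounded_imp_bdd_above compact_imp_bounded compact_continuous_image assms(2))
qed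

lemma sup_nonneg:
  assumes "smooth_on \<Omega> g" "compact K" "K \<subseteq> \<Omega>" "K \<noteq> {}"
  shows "0 \<le> (SUP y\<in>K. cmod (iter_partial \<alpha> g y))"
  using sup_upper[OF assms(1-3)] assms(4) by (meson all_not_in_conv norm_ge_zero order_trans)

lemma sup_diff_le:
  assumes "open \<Omega>" "smooth_on \<Omega> g" "smooth_on \<Omega> h" "compact K" "K \<subseteq> \<Omega>" "K \<noteq> {}"
  shows "(SUP y\<in>K. cmod (iter_partial \<alpha> (\<lambda>y. g y - h y) y))
    \<le> (SUP y\<in>K. cmod (iter_partial \<alpha> g y)) + (SUP y\<in>K. cmod (iter_partial \<alpha> h y))"
proof (rule cSUP_least[OF assms(6)])
  fix y assume y: "y \<in> K"
  then have "cmod (iter_partial \<alpha> (\<lambda>y. g y - h y) y) \<le> cmod (iter_partial \<alpha> g y) + cmod (iter_partial \<alpha> h y)"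
    using assms by (subst iter_partial_diff[OF assms(1-3)]) (auto intro: norm_triangle_ineq4)
  with sup_upper[OF assms(2,4,5) y, of \<alpha>] sup_upper[OF assms(3,4,5) y, of \<alpha>]
  show "cmod (iter_partial \<alpha> (\<lambda>y. g y - h y) y)
    \<le> (SUP y\<in>K. cmod (iter_partial \<alpha> g y)) + (SUP y\<in>K. cmod (iter_partial \<alpha> h y))"
    by linarith
qed

lemma negligible_families_diff:
  assumes "open \<Omega>" "u \<in> negligible_families \<Omega>" "w \<in> negligible_families \<Omega>"
  shows "(\<lambda>x y. u x y - w x y) \<in> negligible_families \<Omega>"
proof -
  have ev: "\<forall>\<^sub>F x in at_top. smooth_on \<Omega> (u x) \<and> smooth_on \<Omega> (w x)"
    using assms(2,3) by (auto simp: negligible_families_def intro: eventually_conj)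
  have "(\<lambda>x. SUP y\<in>K. cmod (iter_partial \<alpha> (\<lambda>y. u x y - w x y) y)) \<in> O(\<lambda>x. 1 / x ^ N)"
    if K: "compact K" "K \<subseteq> \<Omega>" "K \<noteq> {}" for K \<alpha> and N :: nat
  proof (rule landau_o.big_trans)
    show "(\<lambda>x. (SUP y\<in>K. cmod (iter_partial \<alpha> (u x) y)) + (SUP y\<in>K. cmod (iter_partial \<alpha> (w x) y)))
            \<in> O(\<lambda>x. 1 / x ^ N)"
      using assms(2,3) K by (intro sum_in_bigo(1)) (auto simp: negligible_families_def)
    show "(\<lambda>x. SUP y\<in>K. cmod (iter_partial \<alpha> (\<lambda>y. u x y - w x y) y)) \<in>
        O(\<lambda>x. (SUP y\<in>K. cmod (iter_partial \<alpha> (u x) y)) + (SUP y\<in>K. cmod (iter_partial \<alpha> (w x) y)))"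
    proof (rule landau_o.big_mono, rule eventually_mono[OF ev])
      fix x assume x: "smooth_on \<Omega> (u x) \<and> smooth_on \<Omega> (w x)"
      with sup_diff_le[OF assms(1), of "u x" "w x" K \<alpha>] K
        sup_nonneg[OF smooth_on_diff[OF assms(1), of "u x" "w x"], of K \<alpha>]
      show "norm (SUP y\<in>K. cmod (iter_partial \<alpha> (\<lambda>y. u x y - w x y) y)) \<le>
        norm ((SUP y\<in>K. cmod (iter_partial \<alpha> (u x) y)) + (SUP y\<in>K. cmod (iter_partial \<alpha> (w x) y)))"
        by simp
    qed
  qed
  with ev show ?thesis
    unfolding negligible_families_def
    by (auto intro: eventually_mono smooth_on_diff[OF assms(1)])
qed

lemma zero_negligible_families: "(\<lambda>x y. 0) \<in> negligible_families \<Omega>"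
  by (simp add: negligible_families_def smooth_on_def iter_partial_zero)

lemma equiv_colombeau_rel:
  assumes "open \<Omega>" shows "equiv (moderate_families \<Omega>) (colombeau_rel \<Omega>)"
proof (rule equivI)
  show "colombeau_rel \<Omega> \<subseteq> moderate_families \<Omega> \<times> moderate_families \<Omega>"
    by (auto simp: colombeau_rel_def)
  show "refl_on (moderate_families \<Omega>) (colombeau_rel \<Omega>)"
    by (auto simp: refl_on_def colombeau_rel_def zero_negligible_families)
  show "sym (colombeau_rel \<Omega>)"
    using negligible_families_diff[OF assms zero_negligible_families]
    by (fastforce simp: sym_def colombeau_rel_def)
  show "trans (colombeau_rel \<Omega>)"
  proof (rule transI)
    fix u w z assume *: "(u, w) \<in> colombeau_rel \<Omega>" "(w, z) \<in> colombeau_rel \<Omega>"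
    then have "(\<lambda>x y. z x y - w x y) \<in> negligible_families \<Omega>"
      using negligible_families_diff[OF assms zero_negligible_families, of "\<lambda>x y. w x y - z x y"]
      by (simp add: colombeau_rel_def)
    from negligible_families_diff[OF assms _ this, of "\<lambda>x y. u x y - w x y"] *
    show "(u, z) \<in> colombeau_rel \<Omega>" by (simp add: colombeau_rel_def)
  qed
qed

lemma bigo_of_real:
  assumes "g \<in> O(h)"
  shows "(\<lambda>x::real. complex_of_real (g x)) \<in> O(\<lambda>x. of_real (h x))"
proof -
  obtain c where "c > 0" "\<forall>\<^sub>F x in at_top. norm (g x) \<le> c * norm (h x)"
    using assms by (rule landau_o.bigE)
  then show ?thesis by (intro landau_o.bigI[of c]) simp_all
qed

lemma moderate_of_real_pow:
  assumes "g \<in> O(\<lambda>x. x ^ N)" shows "moderate (\<lambda>x. of_real (g x))"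
  unfolding moderate_def using bigo_of_real[OF assms] by blast

lemma moderate_point_value:
  assumes "u \<in> moderate_families \<Omega>" "point_rep \<Omega> \<xi> p"
  shows "moderate (\<lambda>x. u x (p x))"
proof -
  from assms(2) obtain K where K: "compact K" "K \<subseteq> \<Omega>" "\<forall>\<^sub>F x in at_top. p x \<in> K"
    by (auto simp: point_rep_def)
  have "K \<noteq> {}" using K(3) eventually_happens'[OF trivial_limit_at_top_linorder] by blast
  with K assms(1) obtain N :: nat where "(\<lambda>x. SUP y\<in>K. cmod (iter_partial [] (u x) y)) \<in> O(\<lambda>x. x ^ N)"
    unfolding moderate_families_def by blast
  from moderate_of_real_pow[OF this] show ?thesis
  proof (rule moderate_bound)
    have "\<forall>\<^sub>F x in at_top. smooth_on \<Omega> (u x)" using assms(1) by (simp add: moderate_families_def)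
    with K(3) show "\<forall>\<^sub>F x in at_top. norm (u x (p x))
        \<le> norm (complex_of_real (SUP y\<in>K. cmod (iter_partial [] (u x) y)))"
      by eventually_elim (use sup_upper[of \<Omega> _ K _ "[]"] K in \<open>fastforce intro: order_trans\<close>)
  qed
qed

lemma negligible_point_value:
  assumes "u \<in> negligible_families \<Omega>" "point_rep \<Omega> \<xi> p"
  shows "negligible_germ (\<lambda>x. u x (p x))"
proof -
  from assms(2) obtain K where K: "compact K" "K \<subseteq> \<Omega>" "\<forall>\<^sub>F x in at_top. p x \<in> K"
    by (auto simp: point_rep_def)
  have "K \<noteq> {}" using K(3) eventually_happens'[OF trivial_limit_at_top_linorder] by blast
  with K assms(1) have "(\<lambda>x. SUP y\<in>K. cmod (iter_partial [] (u x) y)) \<in> O(\<lambda>x. 1 / x ^ N)" for N :: nat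
    unfolding negligible_families_def by blast
  then have "negligible_germ (\<lambda>x. of_real (SUP y\<in>K. cmod (iter_partial [] (u x) y)))"
    unfolding negligible_germ_def using bigo_of_real by blast
  then show ?thesis
  proof (rule negligible_bound)
    have "\<forall>\<^sub>F x in at_top. smooth_on \<Omega> (u x)" using assms(1) by (simp add: negligible_families_def)
    with K(3) show "\<forall>\<^sub>F x in at_top. norm (u x (p x))
        \<le> norm (complex_of_real (SUP y\<in>K. cmod (iter_partial [] (u x) y)))"
      by eventually_elim (use sup_upper[of \<Omega> _ K _ "[]"] K in \<open>fastforce intro: order_trans\<close>)
  qed
qed

lemma smooth_on_line_bound:
  fixes a :: "real ^ 'd"
  assumes g: "smooth_on \<Omega> g" and K: "compact K" "K \<subseteq> \<Omega>"
    and seg: "\<And>s. s \<in> {0..1} \<Longrightarrow> a + (s * t) *\<^sub>R axis i 1 \<in> K"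
  shows "cmod (g (a + t *\<^sub>R axis i 1) - g a) \<le> (SUP y\<in>K. cmod (iter_partial [i] g y)) * \<bar>t\<bar>"
proof -
  let ?B = "SUP y\<in>K. cmod (iter_partial [i] g y)"
  let ?L = "\<lambda>s. a + (s * t) *\<^sub>R axis i 1"
  have "((\<lambda>s. g (?L s)) has_vector_derivative t *\<^sub>R iter_partial [i] g (?L s)) (at s within {0..1})"
    if "s \<in> {0..1}" for s
  proof -
    have "((\<lambda>h. g (?L s + h *\<^sub>R axis i 1)) has_vector_derivative iter_partial [i] g (?L s))
        (at ((s - s) * t))"
      using smooth_on_has_vector_derivative[OF g, of "?L s" "[]" i] seg[OF that] K by auto
    then have "((\<lambda>h. g (?L s + h *\<^sub>R axis i 1)) \<circ> (\<lambda>z. (z - s) * t) has_vector_derivative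
        t *\<^sub>R iter_partial [i] g (?L s)) (at s)"
      by (intro vector_diff_chain_at)
         (auto intro!: derivative_eq_intros simp flip: has_real_derivative_iff_has_vector_derivative)
    moreover have "(\<lambda>h. g (?L s + h *\<^sub>R axis i 1)) \<circ> (\<lambda>z. (z - s) * t) = (\<lambda>s. g (?L s))"
      by (auto simp: algebra_simps simp flip: scaleR_add_left)
    ultimately show ?thesis by (simp add: has_vector_derivative_at_within)
  qed
  moreover have "onorm (\<lambda>h. h *\<^sub>R (t *\<^sub>R iter_partial [i] g (?L s))) \<le> ?B * \<bar>t\<bar>"
    if "s \<in> {0..1}" for s
  proof (rule onorm_le)
    fix h :: real
    have "\<bar>h * t\<bar> * cmod (iter_partial [i] g (?L s)) \<le> \<bar>h * t\<bar> * ?B"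
      by (intro mult_left_mono sup_upper[OF g K seg[OF that]]) auto
    then show "norm (h *\<^sub>R (t *\<^sub>R iter_partial [i] g (?L s))) \<le> ?B * \<bar>t\<bar> * norm h"
      by (simp add: abs_mult mult_ac)
  qed
  ultimately have "cmod (g (?L 1) - g (?L 0)) \<le> ?B * \<bar>t\<bar> * norm (1 - 0 :: real)"
    unfolding has_vector_derivative_def
    by (intro differentiable_bound[where S = "{0..1}" and f' = "\<lambda>s h. h *\<^sub>R (t *\<^sub>R iter_partial [i] g (?L s))"])
       auto
  then show ?thesis by simp
qed

lemma smooth_on_ball_bound:
  fixes a b :: "real ^ 'd"
  assumes g: "smooth_on \<Omega> g" and K: "compact K" "K \<subseteq> \<Omega>" and sub: "cball a (norm (b - a)) \<subseteq> K"
  shows "cmod (g b - g a) \<le> (\<Sum>i\<in>UNIV. (SUP y\<in>K. cmod (iter_partial [i] g y)) * \<bar>b $ i - a $ i\<bar>)"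
proof -
  let ?B = "\<lambda>i. SUP y\<in>K. cmod (iter_partial [i] g y)"
  let ?z = "\<lambda>S. \<chi> i. if i \<in> S then b $ i else a $ i"
  have "cmod (g (?z S) - g a) \<le> (\<Sum>i\<in>S. ?B i * \<bar>b $ i - a $ i\<bar>)" for S :: "'d set"
    using finite[of S]
  proof (induction S rule: finite_induct)
    case (insert j S)
    let ?t = "b $ j - a $ j"
    have step: "?z (insert j S) = ?z S + ?t *\<^sub>R axis j 1"
      using insert.hyps by (auto simp: vec_eq_iff axis_def)
    have "?z S + (s * ?t) *\<^sub>R axis j 1 \<in> K" if "s \<in> {0..1}" for s
    proof -
      have "\<bar>s * ?t\<bar> \<le> 1 * \<bar>?t\<bar>" using that unfolding abs_mult by (intro mult_right_mono) auto
      then have "norm (?z S + (s * ?t) *\<^sub>R axis j 1 - a) \<le> norm (b - a)"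
        using insert.hyps by (intro norm_le_componentwise_cart) (auto simp: axis_def)
      then show ?thesis using sub by (auto simp: dist_norm norm_minus_commute)
    qed
    from smooth_on_line_bound[OF g K this]
    have "cmod (g (?z (insert j S)) - g (?z S)) \<le> ?B j * \<bar>?t\<bar>" unfolding step .
    with insert.IH norm_triangle_ineq[of "g (?z (insert j S)) - g (?z S)" "g (?z S) - g a"]
    show ?case using insert.hyps by simp
  qed simp
  from this[of UNIV] show ?thesis by simp
qed

lemma point_value_cong:
  fixes \<Omega> :: "(real ^ 'd) set"
  assumes "open \<Omega>" and u: "u \<in> moderate_families \<Omega>"
    and p: "point_rep \<Omega> \<xi> p" and p': "point_rep \<Omega> \<xi> p'"
  shows "negligible_germ (\<lambda>x. u x (p x) - u x (p' x))"
proof -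
  from p' obtain K where K: "compact K" "K \<subseteq> \<Omega>" "\<forall>\<^sub>F x in at_top. p' x \<in> K"
    by (auto simp: point_rep_def)
  obtain e where e: "e > 0" "(\<Union>y\<in>K. cball y e) \<subseteq> \<Omega>"
    using compact_subset_open_imp_cball_epsilon_subset[OF K(1) assms(1) K(2)] by blast
  let ?K = "\<Union>y\<in>K. cball y e"
  have cK: "compact ?K" by (rule compact_minkowski_sum_cball[OF K(1)])
  have "K \<noteq> {}" using K(3) eventually_happens'[OF trivial_limit_at_top_linorder] by blast
  then have neK: "?K \<noteq> {}" using e(1) by auto
  let ?B = "\<lambda>i x. SUP y\<in>?K. cmod (iter_partial [i] (u x) y)"
  have B: "moderate (\<lambda>x. of_real (?B i x))" for i
    using u cK neK e(2) moderate_of_real_pow unfolding moderate_families_def by blast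
  have d: "negligible_germ (\<lambda>x. of_real (p x $ i) - of_real (p' x $ i))" for i
  proof -
    have "gclass (\<lambda>x. of_real (p x $ i)) = gclass (\<lambda>x. of_real (p' x $ i))"
      using p p' unfolding point_rep_def by metis
    with p p' show ?thesis by (subst (asm) gclass_eq_iff) (auto simp: point_rep_def)
  qed
  have d0: "((\<lambda>x. p x - p' x) \<longlongrightarrow> 0) at_top"
  proof (rule vec_tendstoI)
    fix i
    have "(\<lambda>x. complex_of_real (p x $ i) - of_real (p' x $ i)) \<in> O(\<lambda>x. of_real (1 / x ^ 1))"
      using d[of i] unfolding negligible_germ_def by blast
    then obtain c where c: "\<forall>\<^sub>F x in at_top. norm (complex_of_real (p x $ i) - of_real (p' x $ i))
        \<le> c * norm (complex_of_real (1 / x ^ 1))"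
      by (rule landau_o.bigE)
    have "((\<lambda>x::real. c * norm (complex_of_real (1 / x ^ 1))) \<longlongrightarrow> c * norm (complex_of_real 0)) at_top"
      using tendsto_inverse_0_at_top[OF filterlim_ident]
      by (intro tendsto_intros) (simp add: inverse_eq_divide)
    then have "((\<lambda>x::real. c * norm (complex_of_real (1 / x ^ 1))) \<longlongrightarrow> 0) at_top" by simp
    from Lim_null_comparison[OF _ this, of "\<lambda>x. p x $ i - p' x $ i"] c
    show "((\<lambda>x. (p x - p' x) $ i) \<longlongrightarrow> 0 $ i) at_top"
      by (simp flip: of_real_diff)
  qed
  then have "\<forall>\<^sub>F x in at_top. norm (p x - p' x) < e"
    using e(1) by (auto simp: tendsto_iff dist_norm)
  moreover have "\<forall>\<^sub>F x in at_top. smooth_on \<Omega> (u x)" using u by (simp add: moderate_families_def)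
  ultimately have le: "\<forall>\<^sub>F x in at_top. norm (u x (p x) - u x (p' x))
      \<le> norm (\<Sum>i\<in>UNIV. of_real \<bar>p x $ i - p' x $ i\<bar> * complex_of_real (?B i x))"
    using K(3)
  proof eventually_elim
    case (elim x)
    then have "cball (p' x) (norm (p x - p' x)) \<subseteq> ?K" by auto
    from smooth_on_ball_bound[OF elim(2) cK e(2) this]
    show ?case
      by (simp flip: of_real_mult of_real_sum add: mult.commute)
  qed
  have "negligible_germ (\<lambda>x. \<Sum>i\<in>UNIV. of_real \<bar>p x $ i - p' x $ i\<bar> * complex_of_real (?B i x))"
    using negligible_bound[OF d, of "\<lambda>x. of_real \<bar>p x $ i - p' x $ i\<bar>" i for i]
    by (intro negligible_sum negligible_mult B) (simp flip: of_real_diff)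
  from negligible_bound[OF this le] show ?thesis .
qed

lemma colombeau_graph_eq:
  assumes "open \<Omega>" "f \<in> colombeau \<Omega>" "u \<in> f" "point_rep \<Omega> \<xi> p"
  shows "colombeau_graph \<Omega> f \<xi> = gclass (\<lambda>x. u x (p x))"
  unfolding colombeau_graph_def
proof (rule the_equality)
  show "\<exists>w\<in>f. \<exists>p'. point_rep \<Omega> \<xi> p' \<and> gclass (\<lambda>x. u x (p x)) = gclass (\<lambda>x. w x (p' x))"
    using assms by blast
  fix c assume "\<exists>w\<in>f. \<exists>p'. point_rep \<Omega> \<xi> p' \<and> c = gclass (\<lambda>x. w x (p' x))"
  then obtain w p' where w: "w \<in> f" and p': "point_rep \<Omega> \<xi> p'" and c: "c = gclass (\<lambda>x. w x (p' x))"
    by blast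
  have "(w, u) \<in> colombeau_rel \<Omega>"
    using quotient_eq_iff[OF equiv_colombeau_rel[OF assms(1)] _ _ w assms(3)] assms(2)
    by (simp add: colombeau_def)
  then have wm: "w \<in> moderate_families \<Omega>" and um: "u \<in> moderate_families \<Omega>"
    and d: "(\<lambda>x y. w x y - u x y) \<in> negligible_families \<Omega>" by (auto simp: colombeau_rel_def)
  have "negligible_germ (\<lambda>x. (w x (p' x) - u x (p' x)) + (u x (p' x) - u x (p x)))"
    by (intro negligible_add negligible_point_value[OF d p'] point_value_cong[OF assms(1) um p' assms(4)])
  then show "c = gclass (\<lambda>x. u x (p x))"
    unfolding c
    by (subst gclass_eq_iff) (auto intro: moderate_point_value[OF wm p'] moderate_point_value[OF um assms(4)])
qed

lemma mu_v_point_rep: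
  fixes \<Omega> :: "(real ^ 'd) set"
  assumes "open \<Omega>" "\<xi> \<in> mu_v \<Omega>"
  shows "\<exists>p. point_rep \<Omega> \<xi> p"
proof -
  from assms(2) obtain w dw where w: "w \<in> \<Omega>" and xi: "\<xi> = gvec w + dw"
    and dw: "\<And>i. dw $ i \<in> gen_real" and pos: "val (gnorm dw) > 0" by (auto simp: mu_v_def)
  from dw have "\<forall>i. \<exists>g. moderate g \<and> (\<forall>\<^sub>F x in at_top. g x \<in> \<real>) \<and> dw $ i = gclass g"
    by (auto simp: gen_real_def)
  then obtain g where g: "\<And>i. moderate (g i)" "\<And>i. \<forall>\<^sub>F x in at_top. g i x \<in> \<real>" "\<And>i. dw $ i = gclass (g i)"
    by metis
  define h where "h = (\<lambda>x. \<chi> i. Re (g i x))"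
  have eq: "\<forall>\<^sub>F x in at_top. complex_of_real (h x $ i) = g i x" for i
    using g(2)[of i] by eventually_elim (simp add: h_def)
  have hm: "moderate (\<lambda>x. of_real (h x $ i))" for i
    by (rule moderate_bound[OF g(1)[of i]]) (use eq[of i] in eventually_elim, simp)
  have hq: "dw $ i = gclass (\<lambda>x. of_real (h x $ i))" for i
  proof -
    have "negligible_germ (\<lambda>x. g i x - of_real (h x $ i))"
      by (rule negligible_bound[OF negligible_zero]) (use eq[of i] in eventually_elim, simp)
    then show ?thesis using g(3)[of i] gclass_eq_iff[OF g(1)[of i] hm[of i]] by simp
  qed
  have nh: "norm (\<chi> i. complex_of_real (h x $ i)) = norm (h x)" for x
    by (simp add: norm_vec_def)
  have "gnorm dw = gclass (\<lambda>x. of_real (norm (h x)))"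
    using gnorm_eq[of "\<lambda>i x. of_real (h x $ i)" dw, OF hm hq] by (simp add: nh)
  moreover have "moderate (\<lambda>x. of_real (norm (h x)))"
    using moderate_norm[of "\<lambda>i x. of_real (h x $ i)", OF hm] by (simp add: nh)
  ultimately have "germ_val (\<lambda>x. of_real (norm (h x))) > 0" using pos by (simp add: val_gclass)
  then obtain r where r: "r > 0" "(\<lambda>x. complex_of_real (norm (h x))) \<in> O(\<lambda>x. of_real (1 / x powr r))"
    by (auto simp: germ_val_def less_SUP_iff)
  then obtain c where c: "\<forall>\<^sub>F x in at_top. norm (complex_of_real (norm (h x))) \<le> c * norm (complex_of_real (1 / x powr r))"
    using landau_o.bigE by blast
  have "((\<lambda>x. c * (x powr (- r))) \<longlongrightarrow> c * 0) at_top"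
    using r(1) by (intro tendsto_mult tendsto_const tendsto_neg_powr filterlim_ident) auto
  then have "(h \<longlongrightarrow> 0) at_top"
    using c by (intro Lim_null_comparison[of h "\<lambda>x. c * (x powr (- r))"])
      (auto simp: powr_minus divide_inverse norm_inverse norm_mult elim: eventually_mono)
  moreover obtain e where e: "e > 0" "cball w e \<subseteq> \<Omega>" using assms(1) w open_contains_cball by blast
  ultimately have "\<forall>\<^sub>F x in at_top. norm (h x) < e" by (auto simp: tendsto_iff)
  then have "\<forall>\<^sub>F x in at_top. w + h x \<in> cball w e" by eventually_elim (simp add: dist_norm)
  then have "point_rep \<Omega> \<xi> (\<lambda>x. w + h x)"
    unfolding point_rep_def xi gvec_def
    using e(2) hm by (auto simp: hq gconst_def gclass_add intro!: moderate_add exI[of _ "cball w e"])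
  then show ?thesis by blast
qed

end

theory Submission
  imports Defs "HOL-Computational_Algebra.Fundamental_Theorem_Algebra"
    "HOL-Real_Asymp.Real_Asymp"
begin

text \<open>
  Only the ring of generalized numbers matters: every nonzero \<open>c\<close> of valuation \<open>s\<close> has
  an infinite expansion whose coefficients all have valuation \<open>0\<close>.  With \<open>L = q(ln)\<close> and
  \<open>g = c \<lambda>\<^sup>s\<close>, expand \<open>c = g (1 - L / \<lambda>) \<lambda>\<^bsup>-s\<^esup> / (1 - L / \<lambda>)\<close> as a geometric series in
  \<open>L / \<lambda>\<close>; the \<open>n\<close>-th remainder \<open>c (L / \<lambda>)\<^bsup>n+1\<^esup>\<close> has valuation at least \<open>s + n + 1\<close>.
  The coefficients \<open>g (1 - L / \<lambda>) L\<^sup>k\<close> are linearly \<open>v\<close>-independent, since a nonzero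
  polynomial in \<open>ln x\<close> is bounded away from \<open>0\<close> near infinity and hence does not change
  valuations.  For \<open>c = 0\<close> the zero series is used.
\<close>

section \<open>Valuations of sums, products and multiples by units\<close>

lemma le_germ_valI:
  assumes "\<And>s. s < r \<Longrightarrow> f \<in> O(\<lambda>x. of_real (1 / x powr s))"
  shows "ereal r \<le> germ_val f"
proof (rule dense_le)
  fix y assume "y < ereal r"
  then obtain s where s: "y < ereal s" "ereal s < ereal r"
    using ereal_dense2 by blast
  then have "ereal s \<le> germ_val f"
    unfolding germ_val_def by (intro SUP_upper) (use assms in auto)
  with s show "y \<le> germ_val f" by auto
qed

text \<open>The supremum defining \<open>germ_val\<close> need not be attained: \<open>ln\<close>
  has valuation 0 but is unbounded. Passing from valuations to O-bounds therefore requires a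
  strictly smaller exponent.\<close>

lemma bigo_if_less_germ_val:
  assumes "ereal s < germ_val f"
  shows "f \<in> O(\<lambda>x. of_real (1 / x powr s))"
proof -
  from assms obtain r where "s < r" "f \<in> O(\<lambda>x. of_real (1 / x powr r))"
    by (auto simp: germ_val_def less_SUP_iff)
  then show ?thesis using bigo_powr_mono by (meson less_imp_le)
qed

lemma le_val_add:
  assumes "ereal r \<le> val a" "ereal r \<le> val b"
  shows "ereal r \<le> val (a + b)"
proof -
  obtain f g where f: "moderate f" "a = gclass f" and g: "moderate g" "b = gclass g"
    by (meson gen_complex_cases)
  have "(\<lambda>x. f x + g x) \<in> O(\<lambda>x. of_real (1 / x powr s))" if "s < r" for s
  proof -
    from that have "ereal s < ereal r" by simp
    with assms have "ereal s < germ_val f" "ereal s < germ_val g"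
      unfolding f(2) g(2) val_gclass[OF f(1)] val_gclass[OF g(1)] by (metis less_le_trans)+
    then show ?thesis by (intro sum_in_bigo(1) bigo_if_less_germ_val)
  qed
  then show ?thesis
    using le_germ_valI f g by (simp add: gclass_add val_gclass moderate_add)
qed

lemma le_val_mult:
  assumes "ereal r \<le> val a" "ereal s \<le> val b"
  shows "ereal (r + s) \<le> val (a * b)"
proof -
  obtain f g where f: "moderate f" "a = gclass f" and g: "moderate g" "b = gclass g"
    by (meson gen_complex_cases)
  have "(\<lambda>x. f x * g x) \<in> O(\<lambda>x. of_real (1 / x powr t))" if "t < r + s" for t
  proof -
    \<comment> \<open>The slack \<open>r + s - t\<close> is shared equally, so that each factor gets
      an exponent strictly below its bound.\<close>
    define h where "h = (r + s - t) / 2"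
    then have "h > 0" and t: "t = (r - h) + (s - h)" using that by (auto simp: field_simps)
    have "ereal (r - h) < ereal r" "ereal (s - h) < ereal s" using \<open>h > 0\<close> by simp_all
    with assms have "ereal (r - h) < germ_val f" "ereal (s - h) < germ_val g"
      unfolding f(2) g(2) val_gclass[OF f(1)] val_gclass[OF g(1)] by (metis less_le_trans)+
    then have "(\<lambda>x. f x * g x) \<in> O(\<lambda>x. of_real (1 / x powr (r - h)) * of_real (1 / x powr (s - h)))"
      by (intro landau_o.big.mult bigo_if_less_germ_val)
    moreover have "1 / x powr (r - h) * (1 / x powr (s - h)) = 1 / x powr t" for x :: real
      by (subst t) (simp only: powr_add times_divide_times_eq mult_1)
    ultimately show ?thesis by (simp flip: of_real_mult)
  qed
  then show ?thesis
    using le_germ_valI f g by (simp add: gclass_mult val_gclass moderate_mult)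
qed

lemma gconst_0: "gconst 0 = 0" and gconst_1: "gconst 1 = 1"
  by (simp_all add: gconst_def zero_gen_complex_def one_gen_complex_def)

lemma val_gconst: "0 \<le> val (gconst c)"
proof -
  have "(\<lambda>x. c) \<in> O(\<lambda>x. of_real (1 / x powr s))" if "s < 0" for s
  proof (rule bigo_powr_mono)
    have "\<forall>\<^sub>F x in at_top. norm c \<le> norm c * norm (complex_of_real (1 / x powr 0))"
      using eventually_gt_at_top[of 0] by eventually_elim simp
    then show "(\<lambda>x. c) \<in> O(\<lambda>x. of_real (1 / x powr 0))"
      by (rule bigoI)
  qed (use that in simp)
  from le_germ_valI[of 0, OF this] show ?thesis
    by (simp add: gconst_def val_gclass zero_ereal_def)
qed

lemma val_one: "0 \<le> val 1"
  using val_gconst[of 1] by (simp add: gconst_1)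

lemma le_val_power:
  assumes "ereal r \<le> val a"
  shows "ereal (real n * r) \<le> val (a ^ n)"
proof (induction n)
  case (Suc n)
  from le_val_mult[OF assms this] show ?case by (simp add: algebra_simps)
qed (use val_one in \<open>simp add: zero_ereal_def\<close>)

lemma val_le_val_mult:
  assumes "0 \<le> val u"
  shows "val a \<le> val (a * u)"
proof (rule dense_le)
  fix y assume "y < val a"
  then obtain s where s: "y < ereal s" "ereal s < val a"
    using ereal_dense2 by blast
  with le_val_mult[of s a 0 u] assms have "ereal s \<le> val (a * u)"
    by (simp add: zero_ereal_def)
  with s show "y \<le> val (a * u)" by auto
qed

text \<open>Neither multiplication by \<open>u\<close> nor by its inverse \<open>w\<close> can lower
  a valuation, and together they lead back to \<open>a\<close>.\<close>

lemma val_mult_unit: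
  assumes "0 \<le> val u" "0 \<le> val w" "u * w = 1"
  shows "val (a * u) = val a"
proof (rule antisym)
  show "val (a * u) \<le> val a"
    using val_le_val_mult[OF assms(2), of "a * u"] assms(3) by (simp add: mult.assoc)
qed (rule val_le_val_mult[OF assms(1)])

lemma val_zero: "val 0 = \<infinity>"
proof -
  have "ereal r \<le> germ_val (\<lambda>x. 0)" for r by (rule le_germ_valI) simp
  then have "germ_val (\<lambda>x. 0) = \<infinity>" by (meson ereal_top)
  then show ?thesis by (simp add: zero_gen_complex_def val_gclass)
qed

text \<open>Moderateness bounds the valuation from below by a real number; valuation \<infinity>
  would make the representative negligible.\<close>

lemma val_finite:
  assumes "c \<noteq> 0"
  obtains s where "val c = ereal s"
proof -
  obtain f where f: "moderate f" "c = gclass f" by (rule gen_complex_cases)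
  from f(1) obtain r where "f \<in> O(\<lambda>x. of_real (1 / x powr r))" unfolding moderate_iff_powr by blast
  then have "ereal r \<le> germ_val f" unfolding germ_val_def by (intro SUP_upper) auto
  moreover have "germ_val f \<noteq> \<infinity>"
  proof
    assume "germ_val f = \<infinity>"
    then have "negligible_germ f"
      unfolding negligible_iff_powr by (intro allI bigo_if_less_germ_val) simp
    with f assms show False by (simp add: zero_gen_complex_def gclass_eq_iff)
  qed
  ultimately show thesis using that f by (cases "germ_val f") (auto simp: val_gclass)
qed

lemma val_lambda_powr: "ereal (- s) \<le> val (lambda_powr s)"
proof -
  have "(\<lambda>x. of_real (x powr s) :: complex) \<in> O(\<lambda>x. of_real (1 / x powr - s))"
    by (simp add: powr_minus divide_inverse)
  from bigo_powr_mono[OF this] show ?thesis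
    unfolding lambda_powr_def val_gclass[OF moderate_powr] by (intro le_germ_valI) simp
qed

section \<open>Units, and polynomials in the logarithm\<close>

text \<open>The pointwise inverse is bounded by \<open>1 / e\<close> near infinity, hence moderate
  and of nonnegative valuation. Zeros of \<open>f\<close>, where \<open>inverse\<close> returns 0,
  do not occur at large arguments.\<close>

lemma bounded_below_unit:
  assumes f: "moderate f" and "e > 0" and le: "\<forall>\<^sub>F x in at_top. e \<le> norm (f x)"
  obtains w where "0 \<le> val w" "gclass f * w = 1"
proof
  have ev: "\<forall>\<^sub>F x in at_top. norm (inverse (f x)) \<le> norm (complex_of_real (1 / e))"
    using le by eventually_elim (use \<open>e > 0\<close> le_imp_inverse_le[OF _ \<open>e > 0\<close>] in \<open>simp add: norm_inverse norm_divide inverse_eq_divide\<close>)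
  have m: "moderate (\<lambda>x. inverse (f x))"
    by (rule moderate_bound[OF moderate_const ev])
  have "inverse \<circ> f \<in> O(\<lambda>x. of_real (1 / x powr s))" if "s < 0" for s
  proof (rule landau_o.big_trans[OF landau_o.big_mono])
    show "\<forall>\<^sub>F x in at_top. norm ((inverse \<circ> f) x) \<le> norm (complex_of_real (1 / e))"
      using ev by simp
    have "ereal s < 0" using that by (simp add: zero_ereal_def)
    also have "0 \<le> germ_val (\<lambda>x. complex_of_real (1 / e))"
      using val_gconst[of "complex_of_real (1 / e)"] by (simp only: gconst_def val_gclass[OF moderate_const])
    finally have "ereal s < germ_val (\<lambda>x. complex_of_real (1 / e))" .
    then show "(\<lambda>x. complex_of_real (1 / e)) \<in> O(\<lambda>x. of_real (1 / x powr s))"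
      by (rule bigo_if_less_germ_val)
  qed
  then show "0 \<le> val (gclass (\<lambda>x. inverse (f x)))"
    using le_germ_valI[of 0] by (simp add: val_gclass[OF m] zero_ereal_def o_def)
  have "\<forall>\<^sub>F x in at_top. norm (f x * inverse (f x) - 1) \<le> norm (0 :: complex)"
    using le
  proof eventually_elim
    case (elim x)
    with \<open>e > 0\<close> have "f x \<noteq> 0" by auto
    then show ?case by simp
  qed
  from negligible_bound[OF negligible_zero this]
  have "gclass (\<lambda>x. f x * inverse (f x)) = gclass (\<lambda>x. 1)"
    by (subst gclass_eq_iff) (auto intro: moderate_mult f m)
  then show "gclass f * gclass (\<lambda>x. inverse (f x)) = 1"
    by (simp add: gclass_mult f m one_gen_complex_def)
qed

text \<open>Evaluation at q(ln). Its image contains the complex span of the powers of q(ln), so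
  questions about the span become questions about polynomials.\<close>

definition log_poly :: "complex poly \<Rightarrow> gen_complex" where
  "log_poly p = gclass (\<lambda>x. poly p (of_real (ln x)))"

lemma ln_bigo:
  assumes "s < 0"
  shows "(\<lambda>x. complex_of_real (ln x)) \<in> O(\<lambda>x. of_real (1 / x powr s))"
proof -
  have "ln \<in> O(\<lambda>x::real. x powr (- s))" using assms by real_asymp
  from bigo_of_real[OF this] show ?thesis by (simp add: powr_minus divide_inverse)
qed

lemma moderate_ln: "moderate (\<lambda>x. of_real (ln x))"
  unfolding moderate_iff_powr using ln_bigo[of "-1"] by (intro exI[of _ "-1"]) simp

lemma moderate_log_poly: "moderate (\<lambda>x. poly p (of_real (ln x)))"
  by (induction p) (simp_all add: moderate_add moderate_mult moderate_ln)

lemma log_poly_pCons: "log_poly (pCons c p) = gconst c + gclass (\<lambda>x. of_real (ln x)) * log_poly p"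
  by (simp add: log_poly_def gconst_def gclass_add gclass_mult moderate_mult moderate_ln moderate_log_poly)

lemma log_poly_0: "log_poly 0 = 0"
  by (simp add: log_poly_def zero_gen_complex_def)

lemma log_poly_add: "log_poly (p + q) = log_poly p + log_poly q"
  by (simp add: log_poly_def gclass_add moderate_log_poly)

lemma log_poly_smult: "log_poly (smult c p) = gscale c (log_poly p)"
  by (simp add: log_poly_def gscale_def gconst_def gclass_mult moderate_log_poly)

lemma log_poly_monom: "log_poly (monom 1 n) = gclass (\<lambda>x. of_real (ln x)) ^ n"
  by (induction n) (simp_all add: monom_0 monom_Suc log_poly_pCons log_poly_0 gconst_0 gconst_1)

lemma val_ln: "0 \<le> val (gclass (\<lambda>x. of_real (ln x)))"
  using le_germ_valI[of 0, OF ln_bigo] by (simp add: val_gclass moderate_ln zero_ereal_def)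

lemma val_log_poly: "0 \<le> val (log_poly p)"
proof (induction p)
  case (pCons c p)
  then have "0 \<le> val (gclass (\<lambda>x. of_real (ln x)) * log_poly p)"
    using le_val_mult[of 0 _ 0] val_ln by (simp add: zero_ereal_def)
  then show ?case
    using le_val_add[of 0] val_gconst by (simp add: log_poly_pCons zero_ereal_def)
qed (simp add: log_poly_0 val_zero)

text \<open>A nonconstant complex polynomial grows without bound in modulus and \<open>ln x\<close>
  tends to infinity; a nonzero constant is bounded below by its own modulus.\<close>

lemma log_poly_unit:
  assumes "p \<noteq> 0"
  obtains w where "0 \<le> val w" "log_poly p * w = 1"
proof -
  obtain e where "e > 0" "\<forall>\<^sub>F x in at_top. e \<le> norm (poly p (complex_of_real (ln x)))"
  proof (cases p)
    case (pCons c q)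
    show ?thesis
    proof (cases "q = 0")
      case True
      with pCons assms show ?thesis by (intro that[of "norm c"]) auto
    next
      case False
      from poly_infinity[OF this, of 1 c] obtain R where R: "\<And>z. R \<le> norm z \<Longrightarrow> 1 \<le> norm (poly p z)"
        using pCons by blast
      have "\<forall>\<^sub>F x in at_top. R \<le> ln (x::real)"
        using ln_at_top by (simp add: filterlim_at_top)
      then have "\<forall>\<^sub>F x in at_top. 1 \<le> norm (poly p (complex_of_real (ln x)))"
        by eventually_elim (auto intro: R)
      then show ?thesis using that[of 1] by simp
    qed
  qed
  from bounded_below_unit[OF moderate_log_poly this] that show thesis
    unfolding log_poly_def by blast
qed

lemma val_mult_log_poly:
  assumes "p \<noteq> 0" shows "val (a * log_poly p) = val a"
  using val_mult_unit[OF val_log_poly] log_poly_unit[OF assms] by metis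

text \<open>As \<open>ln x / x\<close> tends to 0, the representative eventually exceeds 1/2. This
  makes the correcting factor in the coefficients harmless for valuations.\<close>

lemma one_minus_ln_div_unit:
  obtains w where "0 \<le> val w" "(1 - gclass (\<lambda>x. of_real (ln x)) * lambda_powr (-1)) * w = 1"
proof -
  let ?f = "\<lambda>x. 1 - complex_of_real (ln x) * of_real (x powr (-1))"
  have m: "moderate ?f" by (intro moderate_diff moderate_mult moderate_const moderate_ln moderate_powr)
  have "\<forall>\<^sub>F x::real in at_top. 1 / 2 \<le> 1 - ln x * x powr (-1)" by real_asymp
  then have "\<forall>\<^sub>F x in at_top. 1 / 2 \<le> norm (?f x)"
  proof eventually_elim
    case (elim x)
    have "norm (?f x) = \<bar>1 - ln x * x powr (-1)\<bar>"
      by (metis norm_of_real of_real_1 of_real_diff of_real_mult)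
    with elim show ?case by linarith
  qed
  moreover have "gclass ?f = 1 - gclass (\<lambda>x. of_real (ln x)) * lambda_powr (-1)"
    unfolding lambda_powr_def one_gen_complex_def
    by (simp only: gclass_mult gclass_diff moderate_mult moderate_ln moderate_powr moderate_const)
  ultimately show thesis using bounded_below_unit[OF m, of "1/2"] that by auto
qed

section \<open>Expansions of generalized numbers and of graphs\<close>

lemma span_log_powers:
  assumes "a \<in> gen_complex.span (range (\<lambda>n. b * gclass (\<lambda>x. of_real (ln x)) ^ n))"
  shows "\<exists>p. a = b * log_poly p"
  using assms
proof (induction rule: gen_complex.span_induct_alt)
  case base
  show ?case by (rule exI[of _ 0]) (simp add: log_poly_0)
next
  case (step c x y)
  then obtain n p where "x = b * log_poly (monom 1 n)" "y = b * log_poly p"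
    by (auto simp: log_poly_monom)
  then have "gscale c x + y = b * log_poly (smult c (monom 1 n) + p)"
    by (simp only: log_poly_add log_poly_smult) (simp add: gscale_def algebra_simps)
  then show ?case by blast
qed

lemma v_expansion_zero: "v_expansion 0 (\<lambda>n. 0) r"
  by (auto simp: v_expansion_def v_asymptotic_def lin_v_independent_def strict_mono_on_def)

lemma v_expansion_exists:
  assumes "c \<noteq> 0"
  obtains a r where "v_expansion c a r" "\<And>n. val (a n) = 0"
proof -
  obtain s where s: "val c = ereal s" using val_finite[OF assms] .
  define L where "L = gclass (\<lambda>x. of_real (ln x))"
  define m where "m = L * lambda_powr (-1)"
  \<comment> \<open>The factor \<open>1 - m\<close> makes the partial sums telescope:
    \<open>1 - m\<close> times the sum of the \<open>m ^ k\<close> for \<open>k \<le> n\<close> is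
    \<open>1 - m ^ Suc n\<close>.\<close>
  define b where "b = c * lambda_powr s * (1 - m)"
  define a where "a = (\<lambda>n::nat. b * L ^ n)"
  define r where "r = (\<lambda>n::nat. s + real n)"
  have val_m: "ereal 1 \<le> val m"
    using le_val_mult[OF _ val_lambda_powr, of 0 L "-1"] val_ln
    by (simp add: m_def L_def zero_ereal_def)
  have cancel: "c * lambda_powr s * lambda_powr (- s) = c"
    by (simp add: mult.assoc lambda_powr_minus)
  have "val (c * lambda_powr s) = 0"
  proof (rule antisym)
    show "0 \<le> val (c * lambda_powr s)"
      using le_val_mult[OF _ val_lambda_powr, of s c s] s by (simp add: zero_ereal_def)
    show "val (c * lambda_powr s) \<le> 0"
    \<comment> \<open>Otherwise multiplying back by \<open>lambda_powr (- s)\<close> would give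
      \<open>c\<close> a valuation above \<open>s\<close>.\<close>
    proof (rule ccontr)
      assume "\<not> ?thesis"
      then obtain t where t: "0 < ereal t" "ereal t < val (c * lambda_powr s)"
        using ereal_dense2[of 0 "val (c * lambda_powr s)"] by (auto simp: not_le)
      with le_val_mult[OF _ val_lambda_powr, of t "c * lambda_powr s" "- s"] s show False
        by (simp add: cancel less_imp_le)
    qed
  qed
  moreover have "0 \<le> val (1 - m)"
  proof -
    have "(0 :: ereal) \<le> ereal 1" by simp
    with val_m have "0 \<le> val m" by (metis order_trans)
    \<comment> \<open>Negation is scaling by -1, so the product estimate covers
      \<open>- m\<close>.\<close>
    then have "ereal 0 \<le> val (gscale (-1) m)"
      using le_val_mult[of 0 "gconst (-1)" 0 m] val_gconst by (simp add: gscale_def zero_ereal_def)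
    then show ?thesis
      using le_val_add[of 0 1 "- m"] val_one by (simp add: gen_complex.scale_minus_left zero_ereal_def)
  qed
  ultimately have val_b: "val b = 0"
    using one_minus_ln_div_unit val_mult_unit unfolding b_def m_def L_def by (metis (lifting))
  then have val_a: "val (a n) = 0" for n
    using val_mult_log_poly[of "monom 1 n" b] by (simp add: a_def L_def log_poly_monom)
  have "lin_v_independent (range a)"
    unfolding lin_v_independent_def
  proof (intro ballI impI)
    fix y assume "y \<in> gen_complex.span (range a)" "y \<noteq> 0"
    moreover from this obtain p where "y = b * log_poly p"
      using span_log_powers[of y b] by (auto simp: a_def L_def)
    \<comment> \<open>Since \<open>y \<noteq> 0\<close> excludes \<open>p = 0\<close>, the log
      polynomial leaves the valuation 0 of \<open>b\<close> unchanged.\<close>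
    ultimately show "val y = 0"
      using val_mult_log_poly[of p b] val_b by (cases "p = 0") (auto simp: log_poly_0)
  qed
  then have "v_asymptotic a r" by (simp add: v_asymptotic_def r_def strict_mono_on_def)
  moreover have "ereal (r n) < val (c - (\<Sum>k\<le>n. a k * lambda_powr (- r k)))" for n
  proof -
    have "lambda_powr (- real k) = lambda_powr (-1) ^ k" for k
    proof (induction k)
      case (Suc k)
      then show ?case using lambda_powr_add[of "-1" "- real k"] by simp
    qed (simp add: lambda_powr_0)
    \<comment> \<open>The \<open>k\<close> extra powers of \<open>lambda_powr (-1)\<close> turn
      \<open>L ^ k\<close> into \<open>m ^ k\<close>.\<close>
    then have "a k * lambda_powr (- r k)
        = (c * lambda_powr s * lambda_powr (- s)) * ((1 - m) * m ^ k)" for k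
      using lambda_powr_add[of "- s" "- real k"]
      by (simp add: a_def b_def r_def m_def power_mult_distrib mult_ac)
    then have "a k * lambda_powr (- r k) = c * ((1 - m) * m ^ k)" for k
      by (simp only: cancel)
    then have "(\<Sum>k\<le>n. a k * lambda_powr (- r k)) = c * (1 - m ^ Suc n)"
      by (simp add: one_diff_power_eq sum_distrib_left lessThan_Suc_atMost del: power_Suc)
    then have "c - (\<Sum>k\<le>n. a k * lambda_powr (- r k)) = c * m ^ Suc n"
      by (simp add: algebra_simps)
    \<comment> \<open>The remainder carries \<open>n + 1\<close> factors \<open>m\<close>, one more
      than the last term kept; hence a weak bound on its valuation yields the strict
      inequality.\<close>
    moreover have "ereal (s + real (Suc n) * 1) \<le> val (c * m ^ Suc n)"
      using s by (intro le_val_mult le_val_power val_m) simp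
    moreover have "ereal (r n) < ereal (s + real (Suc n) * 1)" by (simp add: r_def)
    ultimately show ?thesis by (metis less_le_trans)
  qed
  ultimately show thesis by (intro that[of a r] val_a) (simp add: v_expansion_def)
qed

text \<open>Where the graph vanishes, every coefficient must be 0: the first nonzero one would leave
  a remainder of valuation exactly its exponent. Hence \<open>F n\<close> being nonzero is claimed
  if the graph is nonzero somewhere, and valuation 0 at the points where it is nonzero.\<close>

theorem corollary3:
  fixes \<Omega> :: "(real ^ 'd) set"
    and f :: "(real \<Rightarrow> real ^ 'd \<Rightarrow> complex) set"
  assumes "open \<Omega>"
    and "f \<in> colombeau \<Omega>"
  shows "\<exists>(F :: nat \<Rightarrow> gen_complex ^ 'd \<Rightarrow> gen_complex) (r :: nat \<Rightarrow> gen_complex ^ 'd \<Rightarrow> real).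
    ((\<exists>\<xi>\<in>mu_v \<Omega>. colombeau_graph \<Omega> f \<xi> \<noteq> 0) \<longrightarrow> (\<forall>n. \<exists>\<xi>\<in>mu_v \<Omega>. F n \<xi> \<noteq> 0)) \<and>
    (\<forall>\<xi>\<in>mu_v \<Omega>.
      v_asymptotic (\<lambda>n. F n \<xi>) (\<lambda>n. r n \<xi>) \<and>
      (colombeau_graph \<Omega> f \<xi> \<noteq> 0 \<longrightarrow> (\<forall>n. val (F n \<xi>) = 0)) \<and>
      v_expansion (colombeau_graph \<Omega> f \<xi>) (\<lambda>n. F n \<xi>) (\<lambda>n. r n \<xi>))"
proof -
  have "\<exists>a r. v_expansion c a r \<and> (c \<noteq> 0 \<longrightarrow> (\<forall>n. val (a n) = 0))" for c
    by (metis v_expansion_exists v_expansion_zero)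
  \<comment> \<open>One expansion is chosen per generalized number; composing the choice with the
    graph gives \<open>F\<close> and \<open>r\<close>.\<close>
  then obtain A R where AR: "\<And>c. v_expansion c (A c) (R c)" "\<And>c n. c \<noteq> 0 \<Longrightarrow> val (A c n) = 0"
    by metis
  then have nz: "A c n \<noteq> 0" if "c \<noteq> 0" for c n
    \<comment> \<open>Zero has valuation \<infinity>, not 0.\<close>
    using that val_zero by (metis PInfty_neq_ereal(1) zero_ereal_def)
  show ?thesis
  proof (intro exI conjI ballI impI allI)
    fix n assume "\<exists>\<xi>\<in>mu_v \<Omega>. colombeau_graph \<Omega> f \<xi> \<noteq> 0"
    then show "\<exists>\<xi>\<in>mu_v \<Omega>. A (colombeau_graph \<Omega> f \<xi>) n \<noteq> 0" using nz by blast
  next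
    fix \<xi>
    show "v_expansion (colombeau_graph \<Omega> f \<xi>) (\<lambda>n. A (colombeau_graph \<Omega> f \<xi>) n) (\<lambda>n. R (colombeau_graph \<Omega> f \<xi>) n)"
      by (rule AR(1))
    then show "v_asymptotic (\<lambda>n. A (colombeau_graph \<Omega> f \<xi>) n) (\<lambda>n. R (colombeau_graph \<Omega> f \<xi>) n)"
      by (simp add: v_expansion_def)
    show "val (A (colombeau_graph \<Omega> f \<xi>) n) = 0" if "colombeau_graph \<Omega> f \<xi> \<noteq> 0" for n
      by (rule AR(2)[OF that])
  qed
qed

end
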